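(* Let $k\in\mathbb{N}$ and $m\ge1$. Then (i) $[\![\alpha]\!]<\boldsymbol\phi_k^m(\mathbf0)$ for every $\alpha\in\Phi_k^m$; and (ii) for every set-theoretic ordinal $\boldsymbol\alpha<\boldsymbol\phi_k^m(\mathbf0)$ there exists $\alpha\in\Phi_k^m$ with $[\![\alpha]\!]=\boldsymbol\alpha$.
   Context: Constructive ordinals: $\Omega$ is the set of infinitary terms generated by $0$, successor $\alpha+1$, and limits $\langle\alpha_i\rangle_{i\in\mathbb{N}}$. $o(0)=0$, $o(n+1)=o(n)+1$, $\omega=\langle o(i+1)\rangle_i$. Arithmetic: $\alpha+0=\alpha$, $\alpha+(\beta+1)=(\alpha+\beta)+1$, $\alpha+\langle\beta_i\rangle=\langle\alpha+\beta_i\rangle$; $\alpha\cdot0=0$, $\alpha\cdot(\beta+1)=\alpha\cdot\beta+\alpha$, $\alpha\cdot\langle\beta_i\rangle=\langle\alpha\cdot\beta_i\rangle$; $\alpha^0=o(1)$, $\alpha^{\beta+1}=\alpha^\beta\cdot\alpha$, $\alpha^{\langle\beta_i\rangle}=\langle\alpha^{\beta_i}\rangle$. Constructive Veblen functions: $\phi_0(\gamma)=\omega^\gamma$; $\phi_{k+1}(0)=\langle\phi_k^{(i)}(0)\rangle_i$; $\phi_{k+1}(\gamma+1)=\langle\phi_k^{(i)}(\phi_{k+1}(\gamma)+1)\rangle_i$; $\phi_{k+1}(\langle\gamma_i\rangle)=\langle\phi_{k+1}(\gamma_i)\rangle_i$. $\Phi_k$ is the smallest subset of $\Omega$ containing $0$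 and closed under $+$ and $\phi_i$ for $i<k$; $\Phi_k^1=\Phi_k$, and $\Phi_k^{m+1}$ is the smallest set containing $\{0\}\cup\{\phi_k(\beta):\beta\in\Phi_k^m\}$ and closed under $+$ and $\phi_i$ for $i<k$. $[\![-]\!]:\Omega\to\mathbf{On}$: $[\![0]\!]=\mathbf0$, $[\![\alpha+1]\!]=[\![\alpha]\!]+\mathbf1$, $[\![\langle\alpha_i\rangle]\!]=\bigcup_i[\![\alpha_i]\!]$. Set-theoretic Veblen functions: $\boldsymbol\phi_0(\boldsymbol\alpha)=\boldsymbol\omega^{\boldsymbol\alpha}$; $\boldsymbol\phi_{k+1}(\mathbf0)$ least fixed point of $\boldsymbol\phi_k$; $\boldsymbol\phi_{k+1}(\boldsymbol\alpha+\mathbf1)$ least fixed point of $\boldsymbol\phi_k$ above $\boldsymbol\phi_{k+1}(\boldsymbol\alpha)$; $\boldsymbol\phi_{k+1}(\boldsymbol\alpha)=\bigcup_{\boldsymbol\beta<\boldsymbol\alpha}\boldsymbol\phi_{k+1}(\boldsymbol\beta)$ at limits. $\boldsymbol\phi_k^m$ is the $m$-fold iterate. *)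

theory Defs
  imports "HOL-Library.Infinite_Typeclass"
begin

unbundle cardinal_syntax

section \<open>Constructive ordinals\<close>

datatype Omega = OZero | OSucc Omega | OLim "nat \<Rightarrow> Omega"

primrec o_nat :: "nat \<Rightarrow> Omega" where
  "o_nat 0 = OZero"
| "o_nat (Suc n) = OSucc (o_nat n)"

definition o_omega :: Omega where
  "o_omega = OLim (\<lambda>i. o_nat (i + 1))"

primrec o_add :: "Omega \<Rightarrow> Omega \<Rightarrow> Omega" where
  "o_add \<alpha> OZero = \<alpha>"
| "o_add \<alpha> (OSucc \<beta>) = OSucc (o_add \<alpha> \<beta>)"
| "o_add \<alpha> (OLim \<beta>) = OLim (\<lambda>i. o_add \<alpha> (\<beta> i))"

primrec o_mult :: "Omega \<Rightarrow> Omega \<Rightarrow> Omega" where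
  "o_mult \<alpha> OZero = OZero"
| "o_mult \<alpha> (OSucc \<beta>) = o_add (o_mult \<alpha> \<beta>) \<alpha>"
| "o_mult \<alpha> (OLim \<beta>) = OLim (\<lambda>i. o_mult \<alpha> (\<beta> i))"

primrec o_exp :: "Omega \<Rightarrow> Omega \<Rightarrow> Omega" where
  "o_exp \<alpha> OZero = o_nat 1"
| "o_exp \<alpha> (OSucc \<beta>) = o_mult (o_exp \<alpha> \<beta>) \<alpha>"
| "o_exp \<alpha> (OLim \<beta>) = OLim (\<lambda>i. o_exp \<alpha> (\<beta> i))"

primrec o_veblen_step :: "(Omega \<Rightarrow> Omega) \<Rightarrow> Omega \<Rightarrow> Omega" where
  "o_veblen_step f OZero = OLim (\<lambda>i. (f ^^ i) OZero)"
| "o_veblen_step f (OSucc \<gamma>) = OLim (\<lambda>i. (f ^^ i) (OSucc (o_veblen_step f \<gamma>)))"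
| "o_veblen_step f (OLim \<gamma>) = OLim (\<lambda>i. o_veblen_step f (\<gamma> i))"

primrec o_veblen :: "nat \<Rightarrow> Omega \<Rightarrow> Omega" where
  "o_veblen 0 = o_exp o_omega"
| "o_veblen (Suc k) = o_veblen_step (o_veblen k)"

inductive_set veblen_closure :: "nat \<Rightarrow> Omega set \<Rightarrow> Omega set"
  for k :: nat and X :: "Omega set" where
  base: "\<alpha> \<in> X \<Longrightarrow> \<alpha> \<in> veblen_closure k X"
| add: "\<alpha> \<in> veblen_closure k X \<Longrightarrow> \<beta> \<in> veblen_closure k X \<Longrightarrow>
    o_add \<alpha> \<beta> \<in> veblen_closure k X"
| veblen: "i < k \<Longrightarrow> \<alpha> \<in> veblen_closure k X \<Longrightarrow> o_veblen i \<alpha> \<in> veblen_closure k X"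

definition Phi :: "nat \<Rightarrow> Omega set" where
  "Phi k = veblen_closure k {OZero}"

(* Phi_pow k m is only specified for m \<ge> 1. *)
fun Phi_pow :: "nat \<Rightarrow> nat \<Rightarrow> Omega set" where
  "Phi_pow k (Suc 0) = Phi k"
| "Phi_pow k (Suc (Suc m)) =
    veblen_closure k ({OZero} \<union> {o_veblen k \<beta> | \<beta>. \<beta> \<in> Phi_pow k (Suc m)})"


section \<open>Set-theoretic ordinals\<close>

text \<open>
  HOL has no type of all ordinals. An element of \<open>'a ordinal\<close> is an order type of a well-order
  whose field is a subset of \<open>'a\<close>, so \<open>'a ordinal\<close> consists of all ordinals of cardinality at most
  \<open>|'a|\<close>. Statements about all ordinals are made for \<open>'a ordinal\<close> with \<open>'a\<close> an arbitrary infinite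
  type; infinity of \<open>'a\<close> makes the type closed under successors and countable suprema.
\<close>

quotient_type 'a ordinal = "'a rel" / partial: "\<lambda>r s. r =o s"
proof (rule part_equivpI)
  have "Well_order ({} :: 'a rel)" by simp
  then show "\<exists>r :: 'a rel. r =o r" using ordIso_reflexive by blast
  show "symp (\<lambda>r s :: 'a rel. r =o s)" by (auto intro: sympI ordIso_symmetric)
  show "transp (\<lambda>r s :: 'a rel. r =o s)" by (auto intro: transpI ordIso_transitive)
qed

lemma ordinal_cases:
  obtains r where "Well_order r" "x = abs_ordinal r"
proof -
  have "rep_ordinal x =o rep_ordinal x"
    using Quotient_rep_reflp[OF Quotient_ordinal] .
  then have "Well_order (rep_ordinal x)" by (auto simp: ordIso_def)
  moreover have "x = abs_ordinal (rep_ordinal x)"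
    by (simp add: Quotient_abs_rep[OF Quotient_ordinal])
  ultimately show thesis using that by blast
qed

instantiation ordinal :: (type) linorder
begin

lift_definition less_eq_ordinal :: "'a ordinal \<Rightarrow> 'a ordinal \<Rightarrow> bool" is "\<lambda>r s. r \<le>o s"
  by (meson ordIso_iff_ordLeq ordLeq_transitive)

lift_definition less_ordinal :: "'a ordinal \<Rightarrow> 'a ordinal \<Rightarrow> bool" is "\<lambda>r s. r <o s"
  by (meson ordIso_ordLess_trans ordIso_symmetric ordLess_ordIso_trans)

instance
proof
  fix x y z :: "'a ordinal"
  show "x < y \<longleftrightarrow> x \<le> y \<and> \<not> y \<le> x"
  proof transfer
    fix r s :: "'a rel"
    assume "r =o r" "s =o s"
    then have "Well_order r" "Well_order s" by (auto simp: ordIso_def)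
    then show "r <o s \<longleftrightarrow> r \<le>o s \<and> \<not> s \<le>o r"
      using not_ordLeq_iff_ordLess ordLess_imp_ordLeq by blast
  qed
  show "x \<le> x" by transfer (simp add: ordIso_iff_ordLeq)
  show "x \<le> y \<Longrightarrow> y \<le> z \<Longrightarrow> x \<le> z" by transfer (rule ordLeq_transitive)
  show "x \<le> y \<Longrightarrow> y \<le> x \<Longrightarrow> x = y" by transfer (simp add: ordIso_iff_ordLeq)
  show "x \<le> y \<or> y \<le> x" by transfer (meson ordIso_iff_ordLeq ordLeq_Well_order_simp ordLeq_total)
qed

end

lemma abs_ordinal_le_iff:
  "Well_order r \<Longrightarrow> Well_order s \<Longrightarrow> abs_ordinal r \<le> abs_ordinal s \<longleftrightarrow> r \<le>o s"
  by (rule less_eq_ordinal.abs_eq) (simp_all add: ordIso_reflexive)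

lemma abs_ordinal_less_iff:
  "Well_order r \<Longrightarrow> Well_order s \<Longrightarrow> abs_ordinal r < abs_ordinal s \<longleftrightarrow> r <o s"
  by (rule less_ordinal.abs_eq) (simp_all add: ordIso_reflexive)

lemma abs_ordinal_eqI: "r =o s \<Longrightarrow> abs_ordinal r = abs_ordinal s"
  using Quotient_rel_abs[OF Quotient_ordinal] .

instance ordinal :: (type) wellorder
proof
  fix P :: "'a ordinal \<Rightarrow> bool" and a
  assume step: "\<And>x. (\<And>y. y < x \<Longrightarrow> P y) \<Longrightarrow> P x"
  have "Well_order r \<longrightarrow> P (abs_ordinal r)" for r :: "'a rel"
  proof (induction r rule: wf_induct_rule[OF wf_ordLess])
    case (1 r)
    show ?case
    proof (rule impI, rule step)
      fix y assume r: "Well_order r" and y: "y < abs_ordinal r"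
      obtain s where "Well_order s" "y = abs_ordinal s" by (rule ordinal_cases)
      then show "P y" using 1 r y by (simp add: abs_ordinal_less_iff)
    qed
  qed
  then show "P a" by (metis ordinal_cases)
qed

instantiation ordinal :: (type) conditionally_complete_linorder
begin

definition "inf_ordinal = (min :: 'a ordinal \<Rightarrow> _)"
definition "sup_ordinal = (max :: 'a ordinal \<Rightarrow> _)"
definition "Inf_ordinal (A :: 'a ordinal set) = (LEAST x. x \<in> A)"
definition "Sup_ordinal (A :: 'a ordinal set) = (LEAST x. \<forall>a\<in>A. a \<le> x)"

instance
proof
  fix x z :: "'a ordinal" and X
  show "x \<in> X \<Longrightarrow> Inf X \<le> x" by (simp add: Inf_ordinal_def Least_le)
  show "X \<noteq> {} \<Longrightarrow> (\<And>x. x \<in> X \<Longrightarrow> z \<le> x) \<Longrightarrow> z \<le> Inf X"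
    unfolding Inf_ordinal_def by (metis LeastI equals0I)
  show "x \<in> X \<Longrightarrow> bdd_above X \<Longrightarrow> x \<le> Sup X"
    using LeastI_ex[of "\<lambda>b. \<forall>a\<in>X. a \<le> b"] unfolding Sup_ordinal_def bdd_above_def by blast
  show "X \<noteq> {} \<Longrightarrow> (\<And>x. x \<in> X \<Longrightarrow> x \<le> z) \<Longrightarrow> Sup X \<le> z"
    unfolding Sup_ordinal_def by (simp add: Least_le)
qed (auto simp: inf_ordinal_def sup_ordinal_def)

end

instantiation ordinal :: (type) zero
begin
lift_definition zero_ordinal :: "'a ordinal" is "{}"
  by (simp add: ordIso_reflexive)
instance ..
end

lemma ordinal_zero_le [simp]: "(0 :: 'a ordinal) \<le> x"
proof -
  obtain r where "Well_order r" "x = abs_ordinal r" by (rule ordinal_cases)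
  then show ?thesis
    using ordLess_or_ordLeq[of r "{}"] ordLess_iff_ordIso_Restr[of "{}" r]
    by (auto simp: zero_ordinal_def abs_ordinal_le_iff)
qed

lemma ordinal_not_less_zero [simp]: "\<not> x < (0 :: 'a ordinal)"
  by (simp add: not_less)

definition ord_succ :: "'a ordinal \<Rightarrow> 'a ordinal" where
  "ord_succ x = (LEAST y. x < y)"

definition ord_limit :: "'a ordinal \<Rightarrow> bool" where
  "ord_limit x \<longleftrightarrow> x \<noteq> 0 \<and> (\<nexists>y. x = ord_succ y)"


subsection \<open>Boundedness of small sets of ordinals\<close>

lemma Restr_underS_less:
  assumes r: "Well_order r" and ab: "(a, b) \<in> r" "a \<noteq> b"
  shows "Restr r (underS r a) <o Restr r (underS r b)"
proof -
  let ?s = "Restr r (underS r b)"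
  have wo: "wo_rel r" using r by (simp add: wo_rel_def)
  have s: "Well_order ?s" using r by (rule Well_order_Restr)
  have refl: "(a, a) \<in> r"
    using ab wo wo_rel.REFL[OF wo] by (auto simp: refl_on_def Field_def)
  have "a \<in> underS r b" using ab by (simp add: underS_def)
  then have aF: "a \<in> Field ?s" using refl by (auto simp: Field_def)
  have sub: "underS r a \<subseteq> underS r b"
    using wo_rel.TRANS[OF wo] wo_rel.ANTISYM[OF wo] ab
    by (auto simp: underS_def dest: transD antisymD)
  have "underS ?s a = underS r a"
    using sub \<open>a \<in> underS r b\<close> by (auto simp: underS_def)
  then have "Restr ?s (underS ?s a) = Restr r (underS r a)" using sub by auto
  moreover have "Restr ?s (underS ?s a) <o ?s"
    using underS_Restr_ordLess[OF s] aF by blast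
  ultimately show ?thesis by simp
qed

lemma card_lessThan_ordinal: "|{..<x :: 'a ordinal}| \<le>o |UNIV :: 'a set|"
proof -
  obtain r where r: "Well_order r" "x = abs_ordinal r" by (rule ordinal_cases)
  have "{..<x} \<subseteq> (\<lambda>a. abs_ordinal (Restr r (underS r a))) ` UNIV"
  proof
    fix y assume y: "y \<in> {..<x}"
    obtain s where s: "Well_order s" "y = abs_ordinal s" by (rule ordinal_cases)
    with r y have "s <o r" by (simp add: abs_ordinal_less_iff)
    then obtain a where "s =o Restr r (underS r a)"
      using ordLess_iff_ordIso_Restr r s by blast
    then show "y \<in> (\<lambda>a. abs_ordinal (Restr r (underS r a))) ` UNIV"
      using s abs_ordinal_eqI by blast
  qed
  then show ?thesis
    using card_of_image card_of_mono1 ordLeq_transitive by blast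
qed

lemma strict_mono_ordinal_ge:
  fixes h :: "'a ordinal \<Rightarrow> 'a ordinal"
  assumes "\<And>x y. x < y \<Longrightarrow> h x < h y"
  shows "x \<le> h x"
proof (induction x rule: less_induct)
  case (less x)
  show ?case
  proof (rule ccontr)
    assume "\<not> x \<le> h x"
    then have "h x < x" by simp
    then have "h x \<le> h (h x)" "h (h x) < h x" using less assms by blast+
    then show False by simp
  qed
qed

lemma not_card_ordinal_le: "\<not> |UNIV :: 'a ordinal set| \<le>o |UNIV :: 'a set|"
proof
  assume "|UNIV :: 'a ordinal set| \<le>o |UNIV :: 'a set|"
  then obtain f :: "'a ordinal \<Rightarrow> 'a" where f: "inj f"
    using card_of_ordLeq[of "UNIV :: 'a ordinal set" "UNIV :: 'a set"] by blast
  define R :: "'a ordinal rel" where "R = {(x, y). x \<le> y}"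
  have FR: "Field R = UNIV" by (auto simp: R_def Field_def)
  have "R - Id = {(x, y). x < y}" by (auto simp: R_def)
  then have R: "Well_order R"
    using wf FR unfolding well_order_on_def linear_order_on_def partial_order_on_def preorder_on_def
    by (auto simp: R_def refl_on_def trans_def antisym_def total_on_def)
  define r where "r = dir_image R f"
  have "R =o r"
    unfolding r_def using R f FR by (intro dir_image_ordIso) (auto intro: inj_on_subset)
  then have r: "Well_order r" by (simp add: ordIso_def)
  have rf: "(f x, f y) \<in> r" if "x \<le> y" for x y
    using that by (auto simp: r_def dir_image_def R_def)
  define h where "h x = abs_ordinal (Restr r (underS r (f x)))" for x
  have W: "Well_order (Restr r (underS r (f x)))" for x using r by (rule Well_order_Restr)
  have mono: "h x < h y" if "x < y" for x y
    unfolding h_def abs_ordinal_less_iff[OF W W]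
    using that f rf[of x y] by (intro Restr_underS_less r) (auto dest: injD)
  have "h (abs_ordinal r) < abs_ordinal r"
    unfolding h_def abs_ordinal_less_iff[OF W r]
    using rf by (intro underS_Restr_ordLess r) (auto simp: Field_def)
  moreover have "abs_ordinal r \<le> h (abs_ordinal r)"
    using mono by (rule strict_mono_ordinal_ge)
  ultimately show False by simp
qed

lemma ordinal_small_bounded:
  fixes A :: "'a::infinite ordinal set"
  assumes A: "|A| \<le>o |UNIV :: 'a set|"
  shows "\<exists>b. \<forall>x\<in>A. x < b"
proof (rule ccontr)
  assume "\<not> ?thesis"
  then have unb: "\<forall>b. \<exists>x\<in>A. b \<le> x" by (meson not_less)
  have inf: "\<not> finite (UNIV :: 'a set)" by (rule infinite_UNIV)
  have "|\<Union>x\<in>A. {..<x}| \<le>o |UNIV :: 'a set|"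
    by (rule card_of_UNION_ordLeq_infinite[OF inf A]) (simp add: card_lessThan_ordinal)
  then have "|(\<Union>x\<in>A. {..<x}) \<union> A| \<le>o |UNIV :: 'a set|"
    using A inf card_of_Card_order[of "UNIV :: 'a set"]
    by (intro card_of_Un_ordLeq_infinite_Field) (auto simp: Field_card_of)
  moreover have "(\<Union>x\<in>A. {..<x}) \<union> A = UNIV"
    using unb by (auto simp: order_le_less)
  ultimately show False using not_card_ordinal_le by metis
qed

lemma ordinal_bdd_above_range [simp]:
  "bdd_above (range (f :: nat \<Rightarrow> 'a::infinite ordinal))"
proof -
  have "|range f| \<le>o |UNIV :: 'a set|"
    using card_of_image infinite_UNIV infinite_iff_card_of_nat ordLeq_transitive by blast
  then show ?thesis
    using ordinal_small_bounded by (meson bdd_above.I less_imp_le)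
qed

lemma ordinal_bdd_above_image_lessThan [simp]:
  fixes f :: "'a ordinal \<Rightarrow> 'a::infinite ordinal"
  shows "bdd_above (f ` {..<x})"
proof -
  have "|f ` {..<x}| \<le>o |UNIV :: 'a set|"
    using card_of_image card_lessThan_ordinal ordLeq_transitive by blast
  then show ?thesis
    using ordinal_small_bounded by (meson bdd_above.I less_imp_le)
qed

lemma ord_succ_greater [simp]: "x < ord_succ (x :: 'a::infinite ordinal)"
proof -
  have "|range (\<lambda>_ :: nat. x)| \<le>o |UNIV :: 'a set|"
    using card_of_image infinite_UNIV infinite_iff_card_of_nat ordLeq_transitive by blast
  then obtain b where "x < b" using ordinal_small_bounded by blast
  then show ?thesis unfolding ord_succ_def by (rule LeastI)
qed

lemma ord_succ_le_iff: "ord_succ x \<le> y \<longleftrightarrow> x < (y :: 'a::infinite ordinal)"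
proof
  assume "ord_succ x \<le> y"
  then show "x < y" using ord_succ_greater order_less_le_trans by blast
next
  assume "x < y"
  then show "ord_succ x \<le> y" unfolding ord_succ_def by (rule Least_le)
qed

lemma ord_succ_inject [simp]: "ord_succ x = ord_succ y \<longleftrightarrow> x = (y :: 'a::infinite ordinal)"
proof
  assume eq: "ord_succ x = ord_succ y"
  have "\<not> x < y" using eq ord_succ_le_iff[of x y] ord_succ_le_iff[of y y] by auto
  moreover have "\<not> y < x" using eq ord_succ_le_iff[of y x] ord_succ_le_iff[of x x] by auto
  ultimately show "x = y" by simp
qed simp

lemma ord_succ_neq_zero [simp]: "ord_succ x \<noteq> (0 :: 'a::infinite ordinal)"
  using ord_succ_greater[of x] by (auto simp del: ord_succ_greater)


subsection \<open>Transfinite recursion, arithmetic and Veblen functions\<close>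

function ord_rec ::
  "'a::infinite ordinal \<Rightarrow> ('a ordinal \<Rightarrow> 'a ordinal) \<Rightarrow> 'a ordinal \<Rightarrow> 'a ordinal" where
  "ord_rec z s x =
    (if x = 0 then z
     else if \<exists>y. x = ord_succ y then s (ord_rec z s (THE y. x = ord_succ y))
     else (SUP y\<in>{..<x}. ord_rec z s y))"
  by auto
termination
  by (relation "inv_image {(x, y). x < y} (\<lambda>(_, _, x). x)") (auto simp: wf)

declare ord_rec.simps [simp del]

lemma ord_rec_zero: "ord_rec z s 0 = z"
  by (subst ord_rec.simps) simp

lemma ord_rec_succ: "ord_rec z s (ord_succ x) = s (ord_rec z s x)"
  by (subst ord_rec.simps) auto

lemma ord_rec_limit: "ord_limit x \<Longrightarrow> ord_rec z s x = (SUP y\<in>{..<x}. ord_rec z s y)"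
  by (subst ord_rec.simps) (auto simp: ord_limit_def)

definition ord_omega :: "'a::infinite ordinal" where
  "ord_omega = (LEAST x. ord_limit x)"

definition ord_add :: "'a::infinite ordinal \<Rightarrow> 'a ordinal \<Rightarrow> 'a ordinal" where
  "ord_add x = ord_rec x ord_succ"

definition ord_mult :: "'a::infinite ordinal \<Rightarrow> 'a ordinal \<Rightarrow> 'a ordinal" where
  "ord_mult x = ord_rec 0 (\<lambda>v. ord_add v x)"

definition ord_exp :: "'a::infinite ordinal \<Rightarrow> 'a ordinal \<Rightarrow> 'a ordinal" where
  "ord_exp x = ord_rec (ord_succ 0) (\<lambda>v. ord_mult v x)"

primrec veblen :: "nat \<Rightarrow> 'a::infinite ordinal \<Rightarrow> 'a ordinal" where
  "veblen 0 = ord_exp ord_omega"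
| "veblen (Suc k) =
    ord_rec (LEAST x. veblen k x = x) (\<lambda>v. LEAST x. veblen k x = x \<and> v < x)"

lemma veblen_Suc_zero: "veblen (Suc k) 0 = (LEAST x. veblen k x = x)"
  by (simp add: ord_rec_zero)

lemma veblen_Suc_succ:
  "veblen (Suc k) (ord_succ x) = (LEAST y. veblen k y = y \<and> veblen (Suc k) x < y)"
  by (simp add: ord_rec_succ)

lemma veblen_Suc_limit:
  "ord_limit x \<Longrightarrow> veblen (Suc k) x = (SUP y\<in>{..<x}. veblen (Suc k) y)"
  by (simp add: ord_rec_limit)

primrec denote :: "Omega \<Rightarrow> 'a::infinite ordinal" where
  "denote OZero = 0"
| "denote (OSucc \<alpha>) = ord_succ (denote \<alpha>)"
| "denote (OLim \<alpha>) = (SUP i. denote (\<alpha> i))"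

end

theory Submission
  imports Defs
begin

text \<open>
  Denotation commutes with addition and with the Veblen functions, because these are normal
  functions of their last argument and the least fixed point of a normal function above \<open>b\<close> is the
  supremum of its iterates from \<open>b\<close>. Part (i) holds since every value of \<open>veblen k\<close> is closed under
  addition and is a fixed point of \<open>veblen i\<close> for \<open>i < k\<close>. For part (ii), a nonzero ordinal \<open>a\<close> is
  either a sum of two smaller ordinals or a power of \<open>\<omega>\<close>. In the latter case \<open>a\<close> is \<open>veblen i b\<close> for
  some \<open>i < k\<close> and \<open>b < a\<close>, unless it is a fixed point of every \<open>veblen i\<close> with \<open>i < k\<close>; then \<open>a\<close> is
  a value of \<open>veblen k\<close>, and induction on \<open>m\<close> applies to its argument.
\<close>

section \<open>Normal functions\<close>

lemma ordinal_induct [case_names zero succ limit]: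
  fixes x :: "'a::infinite ordinal"
  assumes "P 0" "\<And>x. P x \<Longrightarrow> P (ord_succ x)"
    "\<And>x. ord_limit x \<Longrightarrow> (\<And>y. y < x \<Longrightarrow> P y) \<Longrightarrow> P x"
  shows "P x"
proof (induction x rule: less_induct)
  case (less x)
  then show ?case
    using assms by (cases "ord_limit x") (auto simp: ord_limit_def)
qed

lemma less_ord_succ_iff: "x < ord_succ y \<longleftrightarrow> x \<le> (y :: 'a::infinite ordinal)"
  by (metis ord_succ_le_iff not_le)

lemma ord_limit_succ_less:
  fixes x :: "'a::infinite ordinal"
  assumes "ord_limit x" "y < x"
  shows "ord_succ y < x"
  using assms by (metis ord_limit_def ord_succ_le_iff order_le_less)

lemma ord_limit_pos: "ord_limit x \<Longrightarrow> 0 < x"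
  by (metis ord_limit_def ordinal_zero_le order_le_less)

lemma ord_limit_lessThan_nonempty: "ord_limit x \<Longrightarrow> {..<x} \<noteq> {}"
  using ord_limit_pos by blast

definition normal_fun :: "('a::infinite ordinal \<Rightarrow> 'a ordinal) \<Rightarrow> bool" where
  "normal_fun f \<longleftrightarrow> strict_mono f \<and> (\<forall>x. ord_limit x \<longrightarrow> f x = (SUP y\<in>{..<x}. f y))"

lemma normal_fun_less_iff: "normal_fun f \<Longrightarrow> f x < f y \<longleftrightarrow> x < y"
  by (simp add: normal_fun_def strict_mono_less)

lemma normal_fun_le_iff: "normal_fun f \<Longrightarrow> f x \<le> f y \<longleftrightarrow> x \<le> y"
  by (simp add: normal_fun_def strict_mono_less_eq)

lemma normal_fun_limit: "normal_fun f \<Longrightarrow> ord_limit x \<Longrightarrow> f x = (SUP y\<in>{..<x}. f y)"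
  by (simp add: normal_fun_def)

lemma normal_fun_ge: "normal_fun f \<Longrightarrow> x \<le> f x"
  by (rule strict_mono_ordinal_ge) (simp add: normal_fun_less_iff)

text \<open>Induction on the larger argument: at a limit \<open>y\<close> above \<open>x\<close>,
  \<open>ord_succ x\<close> still lies below \<open>y\<close>, so continuity gives
  \<open>f (ord_succ x) \<le> f y\<close>.\<close>

lemma normal_funI:
  fixes f :: "'a::infinite ordinal \<Rightarrow> 'a ordinal"
  assumes succ: "\<And>x. f x < f (ord_succ x)"
    and limit: "\<And>x. ord_limit x \<Longrightarrow> f x = (SUP y\<in>{..<x}. f y)"
  shows "normal_fun f"
proof -
  have "x < y \<longrightarrow> f x < f y" for x y
  proof (induction y rule: ordinal_induct)
    case (succ y)
    then show ?case
      using assms(1)[of y] by (auto simp: less_ord_succ_iff order_le_less)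
  next
    case (limit y)
    show ?case
    proof
      assume "x < y"
      then have "ord_succ x < y" using limit ord_limit_succ_less by blast
      then have "f (ord_succ x) \<le> f y"
        unfolding assms(2)[OF limit(1)] by (intro cSUP_upper) auto
      then show "f x < f y" using assms(1) less_le_trans by blast
    qed
  qed simp
  then show ?thesis using limit by (auto simp: normal_fun_def strict_mono_def)
qed

text \<open>The recursion never falls below its start \<open>z\<close>, so growth of
  \<open>s\<close> is asked for only from \<open>z\<close> on. Exponentiation relies on this, since
  multiplying by omega does not increase 0.\<close>

lemma normal_fun_ord_rec:
  assumes step: "\<And>v. z \<le> v \<Longrightarrow> v < s v"
  shows "normal_fun (ord_rec z s)"
proof -
  have ge: "z \<le> ord_rec z s x" for x
  proof (induction x rule: ordinal_induct)
    case (succ x)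
    then show ?case using step[of "ord_rec z s x"] by (simp add: ord_rec_succ)
  next
    case (limit x)
    have "ord_rec z s 0 \<le> ord_rec z s x"
      unfolding ord_rec_limit[OF limit(1)]
      using ord_limit_pos[OF limit(1)] by (intro cSUP_upper) auto
    then show ?case by (simp add: ord_rec_zero)
  qed (simp add: ord_rec_zero)
  show ?thesis
    by (rule normal_funI) (simp_all add: ord_rec_succ ord_rec_limit step ge)
qed

text \<open>A supremum that is not attained is a limit in which \<open>A\<close> is cofinal, so
  continuity at that limit gives the claim.\<close>

lemma normal_fun_Sup:
  assumes f: "normal_fun f" and A: "A \<noteq> {}" "bdd_above A"
  shows "f (Sup A) = (SUP a\<in>A. f a)"
proof -
  have ub: "f a \<le> f (Sup A)" if "a \<in> A" for a
    using f A that by (simp add: normal_fun_le_iff cSup_upper)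
  then have bdd: "bdd_above (f ` A)" by (auto simp: bdd_above_def)
  show ?thesis
  proof (rule antisym)
    show "(SUP a\<in>A. f a) \<le> f (Sup A)" using A ub by (intro cSUP_least)
    show "f (Sup A) \<le> (SUP a\<in>A. f a)"
    proof (cases "Sup A \<in> A")
      case True
      then show ?thesis using bdd by (rule cSUP_upper)
    next
      case False
      then have less: "a < Sup A" if "a \<in> A" for a
        using that A by (metis cSup_upper order_le_less)
      have lim: "ord_limit (Sup A)"
        unfolding ord_limit_def
      proof safe
        assume "Sup A = 0"
        then show False using A less by auto
      next
        fix y assume y: "Sup A = ord_succ y"
        then have "Sup A \<le> y"
          using A less by (intro cSup_least) (auto simp: less_ord_succ_iff)
        then show False using y by (simp add: ord_succ_le_iff)
      qed
      show ?thesis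
        unfolding normal_fun_limit[OF f lim]
      proof (rule cSUP_least[OF ord_limit_lessThan_nonempty[OF lim]])
        fix y assume "y \<in> {..<Sup A}"
        then obtain a where a: "a \<in> A" "y < a" using A by (auto simp: less_cSup_iff)
        then have "f y \<le> f a" using f by (simp add: normal_fun_le_iff)
        also have "f a \<le> (SUP a\<in>A. f a)" using a bdd by (intro cSUP_upper)
        finally show "f y \<le> (SUP a\<in>A. f a)" .
      qed
    qed
  qed
qed

lemma normal_fun_SUP:
  "normal_fun f \<Longrightarrow> f (SUP i. g i) = (SUP i :: nat. f (g i))"
  by (simp add: normal_fun_Sup image_image)

text \<open>The least \<open>z\<close> with \<open>x < f z\<close> is not zero by hypothesis and not
  a limit by continuity, so it has a predecessor. This search yields subtraction, the leading power
  of omega and the location of fixed points.\<close>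

lemma normal_fun_bracket:
  assumes f: "normal_fun f" and x: "f 0 \<le> x"
  obtains y where "f y \<le> x" "x < f (ord_succ y)"
proof -
  define z where "z = (LEAST z. x < f z)"
  have "x < f (ord_succ x)"
    using normal_fun_ge[OF f, of x] normal_fun_less_iff[OF f, of x "ord_succ x"] by simp
  then have z: "x < f z" unfolding z_def by (rule LeastI)
  have least: "f y \<le> x" if "y < z" for y
    using that not_less_Least[of y "\<lambda>z. x < f z"] unfolding z_def by auto
  have "z \<noteq> 0" using z x by auto
  moreover have "\<not> ord_limit z"
  proof
    assume lim: "ord_limit z"
    have "f z \<le> x"
      unfolding normal_fun_limit[OF f lim]
      using least by (intro cSUP_least ord_limit_lessThan_nonempty[OF lim]) auto
    then show False using z by simp
  qed
  ultimately obtain y where "z = ord_succ y" by (auto simp: ord_limit_def)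
  then show thesis using that[of y] z least[of y] by simp
qed

section \<open>Fixed points of normal functions\<close>

lemma normal_fun_fixpoint_SUP:
  assumes f: "normal_fun f"
  defines "s \<equiv> \<lambda>b. SUP n. (f ^^ n) b"
  shows "f (s b) = s b \<and> b \<le> s b"
proof -
  have up: "(f ^^ n) b \<le> s b" for n
    unfolding s_def by (intro cSUP_upper) auto
  \<comment> \<open>Continuity turns applying \<open>f\<close> into a shift of the iteration, so
    \<open>f (s b)\<close> cannot exceed \<open>s b\<close>; the converse holds for every normal
    function.\<close>
  have fs: "f (s b) = (SUP n. (f ^^ Suc n) b)"
    using normal_fun_SUP[OF f] by (simp add: s_def)
  have "f (s b) \<le> s b" unfolding fs using up by (intro cSUP_least) blast+
  then show ?thesis
    using normal_fun_ge[OF f, of "s b"] up[of 0] by simp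
qed

text \<open>By monotonicity no iterate of \<open>b\<close> exceeds a fixed point at or above
  \<open>b\<close>. Taking \<open>b\<close> to be 0 or a successor matches the clauses of
  \<open>veblen\<close> at zero and at successors.\<close>

lemma normal_fun_least_fixpoint:
  assumes f: "normal_fun f"
  shows "(LEAST x. f x = x \<and> b \<le> x) = (SUP n. (f ^^ n) b)"
proof (rule Least_equality)
  show "f (SUP n. (f ^^ n) b) = (SUP n. (f ^^ n) b) \<and> b \<le> (SUP n. (f ^^ n) b)"
    by (rule normal_fun_fixpoint_SUP[OF f])
next
  fix x assume x: "f x = x \<and> b \<le> x"
  have "(f ^^ n) b \<le> x" for n
  proof (induction n)
    case (Suc n)
    then show ?case using normal_fun_le_iff[OF f, of _ x] x by simp
  qed (use x in simp)
  then show "(SUP n. (f ^^ n) b) \<le> x" by (intro cSUP_least) auto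
qed

lemma normal_fun_fixpoint_ex: "normal_fun f \<Longrightarrow> \<exists>x. f x = x \<and> b \<le> x"
  using normal_fun_fixpoint_SUP by blast


section \<open>Addition\<close>

lemma ord_add_zero [simp]: "ord_add x 0 = x"
  by (simp add: ord_add_def ord_rec_zero)

lemma ord_add_succ [simp]: "ord_add x (ord_succ y) = ord_succ (ord_add x y)"
  by (simp add: ord_add_def ord_rec_succ)

lemma normal_ord_add: "normal_fun (ord_add x)"
  unfolding ord_add_def by (rule normal_fun_ord_rec) simp

lemma ord_add_ge_left: "x \<le> ord_add x y"
  using normal_fun_le_iff[OF normal_ord_add, of x 0 y] by simp

lemma ord_add_assoc: "ord_add (ord_add x y) z = ord_add x (ord_add y z)"
proof (induction z rule: ordinal_induct)
  case (limit z)
  have "ord_add (ord_add x y) z = (SUP w\<in>{..<z}. ord_add x (ord_add y w))"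
    unfolding normal_fun_limit[OF normal_ord_add limit(1)] using limit by (intro SUP_cong) auto
  also have "\<dots> = ord_add x (SUP w\<in>{..<z}. ord_add y w)"
    using ord_limit_lessThan_nonempty[OF limit(1)]
    by (simp add: normal_fun_Sup[OF normal_ord_add] image_image)
  also have "\<dots> = ord_add x (ord_add y z)"
    unfolding normal_fun_limit[OF normal_ord_add limit(1)] ..
  finally show ?case .
qed simp_all

lemma ord_add_zero_left: "ord_add 0 x = x"
proof (rule antisym)
  show "ord_add 0 x \<le> x"
  proof (induction x rule: ordinal_induct)
    case (succ x)
    then show ?case by (simp add: ord_succ_le_iff less_ord_succ_iff)
  next
    case (limit x)
    then show ?case
      unfolding normal_fun_limit[OF normal_ord_add limit(1)]
      by (intro cSUP_least ord_limit_lessThan_nonempty) (auto intro: less_imp_le le_less_trans)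
  qed simp
  show "x \<le> ord_add 0 x" by (rule normal_fun_ge[OF normal_ord_add])
qed

lemma ord_add_mono_left:
  assumes "x \<le> y"
  shows "ord_add x z \<le> ord_add y z"
proof (induction z rule: ordinal_induct)
  case zero
  then show ?case using assms by simp
next
  case (succ z)
  then show ?case by (simp add: ord_succ_le_iff less_ord_succ_iff)
next
  case (limit z)
  then show ?case
    unfolding normal_fun_limit[OF normal_ord_add limit(1)]
    by (intro cSUP_mono ord_limit_lessThan_nonempty) auto
qed

lemma ord_add_subtract:
  assumes "x \<le> y"
  obtains z where "y = ord_add x z"
proof -
  from assms obtain z where "ord_add x z \<le> y" "y < ord_add x (ord_succ z)"
    using normal_fun_bracket[OF normal_ord_add, of x y] by auto
  then show thesis using that by (simp add: less_ord_succ_iff)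
qed


section \<open>Powers of omega\<close>

abbreviation ord_nat :: "nat \<Rightarrow> 'a::infinite ordinal" where
  "ord_nat n \<equiv> (ord_succ ^^ n) 0"

lemma less_ord_natE:
  assumes "x < ord_nat n"
  obtains m where "x = ord_nat m"
  using assms by (induction n) (auto simp: less_ord_succ_iff order_le_less)

lemma ord_omega_SUP: "(ord_omega :: 'a::infinite ordinal) = (SUP n. ord_nat n)"
  unfolding ord_omega_def
proof (rule Least_equality)
  let ?w = "SUP n. ord_nat n :: 'a ordinal"
  have lt: "ord_nat n < ?w" for n
  proof -
    have "ord_nat (Suc n) \<le> ?w" by (intro cSUP_upper) auto
    then show ?thesis by (simp add: ord_succ_le_iff)
  qed
  have below: "\<exists>m. x = ord_nat m" if x: "x < ?w" for x :: "'a ordinal"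
  proof -
    obtain n where "x < ord_nat n" using x by (auto simp: less_cSUP_iff)
    then show ?thesis using less_ord_natE by blast
  qed
  show "ord_limit ?w"
    unfolding ord_limit_def
  proof safe
    assume "?w = 0"
    then show False using lt[of 0] by simp
  next
    fix y assume y: "?w = ord_succ y"
    then have "y < ?w" by simp
    then obtain m where m: "y = ord_nat m" using below by blast
    show False using lt[of "Suc m"] y m by simp
  qed
  show "?w \<le> x" if x: "ord_limit x" for x
  proof (rule ccontr)
    assume "\<not> ?w \<le> x"
    then obtain m where "x = ord_nat m" using below by force
    then show False using x by (cases m) (auto simp: ord_limit_def)
  qed
qed

lemma ord_mult_zero [simp]: "ord_mult x 0 = 0"
  by (simp add: ord_mult_def ord_rec_zero)

lemma ord_mult_succ [simp]: "ord_mult x (ord_succ y) = ord_add (ord_mult x y) x"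
  by (simp add: ord_mult_def ord_rec_succ)

lemma normal_ord_mult:
  assumes "0 < x"
  shows "normal_fun (ord_mult x)"
  unfolding ord_mult_def
proof (rule normal_fun_ord_rec)
  show "v < ord_add v x" for v
    using normal_fun_less_iff[OF normal_ord_add, of v 0 x] assms by simp
qed

lemma ord_mult_omega: "0 < x \<Longrightarrow> ord_mult x ord_omega = (SUP n. ord_mult x (ord_nat n))"
  unfolding ord_omega_SUP by (rule normal_fun_SUP[OF normal_ord_mult])

abbreviation omega_exp :: "'a::infinite ordinal \<Rightarrow> 'a ordinal" where
  "omega_exp \<equiv> ord_exp ord_omega"

lemma omega_exp_zero [simp]: "omega_exp 0 = ord_succ 0"
  by (simp add: ord_exp_def ord_rec_zero)

lemma omega_exp_succ: "omega_exp (ord_succ x) = ord_mult (omega_exp x) ord_omega"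
  by (simp add: ord_exp_def ord_rec_succ)

lemma normal_omega_exp: "normal_fun omega_exp"
  unfolding ord_exp_def
proof (rule normal_fun_ord_rec)
  fix v :: "'a ordinal" assume "ord_succ 0 \<le> v"
  then have v: "0 < v" by (simp add: ord_succ_le_iff)
  \<comment> \<open>The strict increase is found between the first two multiples: \<open>v\<close>
    is at most \<open>v\<close> times 1, which is less than \<open>v\<close> times 2, which is at
    most \<open>v\<close> times omega.\<close>
  have "ord_mult v (ord_nat (Suc 0)) \<le> ord_mult v ord_omega"
    and "ord_mult v (ord_nat (Suc (Suc 0))) \<le> ord_mult v ord_omega"
    unfolding ord_mult_omega[OF v] by (intro cSUP_upper; simp)+
  moreover have "ord_mult v (ord_nat (Suc 0)) < ord_mult v (ord_nat (Suc (Suc 0)))"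
    by (subst normal_fun_less_iff[OF normal_ord_mult[OF v]]) simp
  moreover have "v \<le> ord_mult v (ord_nat (Suc 0))"
    by (simp add: normal_fun_ge[OF normal_ord_add])
  ultimately show "v < ord_mult v ord_omega" by (meson le_less_trans less_le_trans)
qed

lemma omega_exp_pos: "0 < omega_exp x"
  using normal_fun_le_iff[OF normal_omega_exp, of 0 x] by (simp add: ord_succ_le_iff)

text \<open>At a successor exponent both summands lie below finite multiples of the previous power;
  at a limit exponent both lie below one common smaller power.\<close>

lemma omega_exp_add_closed:
  assumes "x < omega_exp z" "y < omega_exp z"
  shows "ord_add x y < omega_exp z"
  using assms
proof (induction z arbitrary: x y rule: ordinal_induct)
  case zero
  then have "x = 0" "y = 0" by (auto simp: less_ord_succ_iff intro: antisym)
  then show ?case by simp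
next
  case (succ z)
  let ?p = "omega_exp z" and ?q = "omega_exp (ord_succ z)"
  have q: "?q = (SUP n. ord_mult ?p (ord_nat n))"
    unfolding omega_exp_succ by (rule ord_mult_omega[OF omega_exp_pos])
  have below: "\<exists>n. u < ord_mult ?p (ord_nat n)" if "u < ?q" for u
    using that unfolding q by (auto simp: less_cSUP_iff)
  have lt: "ord_mult ?p (ord_nat n) < ?q" for n
  proof -
    have "ord_mult ?p (ord_nat n) < ord_mult ?p (ord_nat (Suc n))"
      by (subst normal_fun_less_iff[OF normal_ord_mult[OF omega_exp_pos]]) simp
    also have "\<dots> \<le> ?q" unfolding q by (rule cSUP_upper) auto
    finally show ?thesis .
  qed
  \<comment> \<open>If \<open>x\<close> plus \<open>n\<close> copies of \<open>?p\<close> is below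
    \<open>j\<close> copies, then one more copy keeps the sum within \<open>j + 1\<close> copies,
    still below \<open>?q\<close>.\<close>
  have *: "ord_add x (ord_mult ?p (ord_nat n)) < ?q" for n
  proof (induction n)
    case 0
    then show ?case using succ by simp
  next
    case (Suc n)
    then obtain j where "ord_add x (ord_mult ?p (ord_nat n)) < ord_mult ?p (ord_nat j)"
      using below by blast
    then have "ord_add (ord_add x (ord_mult ?p (ord_nat n))) ?p \<le> ord_mult ?p (ord_nat (Suc j))"
      by (simp add: ord_add_mono_left)
    also have "\<dots> < ?q" by (rule lt)
    finally show ?case by (simp add: ord_add_assoc)
  qed
  obtain n where "y < ord_mult ?p (ord_nat n)" using below succ by blast
  then have "ord_add x y < ord_add x (ord_mult ?p (ord_nat n))"
    by (simp add: normal_fun_less_iff[OF normal_ord_add])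
  then show ?case using *[of n] by simp
next
  case (limit z)
  have "\<exists>w<z. x < omega_exp w" "\<exists>w<z. y < omega_exp w"
    using limit(3,4) ord_limit_lessThan_nonempty[OF limit(1)]
    unfolding normal_fun_limit[OF normal_omega_exp limit(1)] by (auto simp: less_cSUP_iff)
  then obtain v w where vw: "v < z" "x < omega_exp v" "w < z" "y < omega_exp w" by blast
  define u where "u = max v w"
  have u: "u < z" "v \<le> u" "w \<le> u" using vw by (auto simp: u_def)
  have "x < omega_exp u" "y < omega_exp u"
    using vw u by (meson normal_fun_le_iff[OF normal_omega_exp] less_le_trans)+
  then have "ord_add x y < omega_exp u" using limit(2) u by blast
  also have "\<dots> < omega_exp z" using u by (simp add: normal_fun_less_iff[OF normal_omega_exp])
  finally show ?case .
qed

text \<open>Split off the largest power of omega not exceeding \<open>a\<close>. If it differs from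
  \<open>a\<close>, the remainder is smaller than \<open>a\<close>, since otherwise \<open>a\<close>
  would reach the next power.\<close>

lemma ordinal_omega_exp_or_sum:
  fixes a :: "'a::infinite ordinal"
  assumes "0 < a"
  obtains (power) x where "a = omega_exp x" | (sum) b c where "b < a" "c < a" "a = ord_add b c"
proof -
  have "omega_exp 0 \<le> a" using assms by (simp add: ord_succ_le_iff)
  then obtain x where x: "omega_exp x \<le> a" "a < omega_exp (ord_succ x)"
    using normal_fun_bracket[OF normal_omega_exp] by blast
  show thesis
  proof (cases "omega_exp x = a")
    case True
    then show thesis using power by blast
  next
    case False
    obtain c where c: "a = ord_add (omega_exp x) c" using x ord_add_subtract by blast
    have "c \<noteq> a"
    proof
      \<comment> \<open>Adding \<open>\<omega>\<^sup>x\<close> on the left is absorbed by \<open>a\<close>, hence so is \<open>\<omega>\<^sup>x \<cdot> n\<close> for every \<open>n\<close>.\<close>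
      assume "c = a"
      then have absorb: "ord_add (omega_exp x) a = a" using c by simp
      have "ord_add (ord_mult (omega_exp x) (ord_nat n)) a = a" for n
      proof (induction n)
        case 0
        show ?case by (simp add: ord_add_zero_left)
      next
        case (Suc n)
        then show ?case by (simp add: ord_add_assoc absorb)
      qed
      then have "ord_mult (omega_exp x) (ord_nat n) \<le> a" for n
        by (metis ord_add_ge_left)
      then have "omega_exp (ord_succ x) \<le> a"
        unfolding omega_exp_succ ord_mult_omega[OF omega_exp_pos] by (intro cSUP_least) auto
      then show False using x by simp
    qed
    moreover have "c \<le> a" unfolding c by (rule normal_fun_ge[OF normal_ord_add])
    ultimately show thesis using sum[of "omega_exp x" c] False x c by simp
  qed
qed


section \<open>Veblen functions\<close>

text \<open>Fixed points of a normal function are unbounded, so the minimum taken in the recursion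
  step exists and exceeds \<open>v\<close>.\<close>

lemma normal_veblen_Suc:
  assumes "normal_fun (veblen k :: 'a::infinite ordinal \<Rightarrow> 'a ordinal)"
  shows "normal_fun (veblen (Suc k) :: 'a ordinal \<Rightarrow> 'a ordinal)"
  unfolding veblen.simps
proof (rule normal_fun_ord_rec)
  fix v :: "'a ordinal"
  obtain x where "veblen k x = x \<and> v < x"
    using normal_fun_fixpoint_ex[OF assms, of "ord_succ v"] by (auto simp: ord_succ_le_iff)
  then show "v < (LEAST x. veblen k x = x \<and> v < x)" by (rule LeastI2) simp
qed

lemma normal_veblen: "normal_fun (veblen k)"
proof (induction k)
  case 0
  then show ?case by (simp add: normal_omega_exp)
next
  case (Suc k)
  then show ?case by (rule normal_veblen_Suc)
qed

lemma veblen_Suc_fixpoint: "veblen k (veblen (Suc k) x) = veblen (Suc k) x"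
proof (induction x rule: ordinal_induct)
  case zero
  show ?case
    unfolding veblen_Suc_zero
    by (rule LeastI_ex) (use normal_fun_fixpoint_ex[OF normal_veblen] in blast)
next
  case (succ x)
  have "\<exists>y. veblen k y = y \<and> veblen (Suc k) x < y"
    using normal_fun_fixpoint_ex[OF normal_veblen, of k "ord_succ (veblen (Suc k) x)"]
    by (simp only: ord_succ_le_iff)
  then show ?case unfolding veblen_Suc_succ by (rule LeastI2_ex) simp
next
  case (limit x)
  \<comment> \<open>By continuity, a supremum of fixed points of \<open>veblen k\<close> is again a
    fixed point.\<close>
  have "veblen k (veblen (Suc k) x) = (SUP y\<in>{..<x}. veblen k (veblen (Suc k) y))"
    unfolding veblen_Suc_limit[OF limit(1)]
    using ord_limit_lessThan_nonempty[OF limit(1)]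
    by (simp add: normal_fun_Sup[OF normal_veblen] image_image del: veblen.simps)
  also have "\<dots> = (SUP y\<in>{..<x}. veblen (Suc k) y)"
    using limit by (intro SUP_cong) auto
  finally show ?case unfolding veblen_Suc_limit[OF limit(1)] .
qed

text \<open>Bracket \<open>x\<close> between consecutive values. The upper one is the least fixed
  point beyond the lower one, so no fixed point lies strictly between them.\<close>

lemma fixpoint_in_range_veblen_Suc:
  assumes "veblen k x = x"
  shows "x \<in> range (veblen (Suc k))"
proof -
  have "veblen (Suc k) 0 \<le> x" unfolding veblen_Suc_zero using assms by (rule Least_le)
  then obtain y where y: "veblen (Suc k) y \<le> x" "x < veblen (Suc k) (ord_succ y)"
    using normal_fun_bracket[OF normal_veblen] by blast
  have "\<not> veblen (Suc k) y < x"
  proof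
    assume "veblen (Suc k) y < x"
    then have "veblen (Suc k) (ord_succ y) \<le> x"
      unfolding veblen_Suc_succ using assms by (intro Least_le) simp
    then show False using y by simp
  qed
  then have "x = veblen (Suc k) y" using y by simp
  then show ?thesis by blast
qed

lemma veblen_fixpoint:
  assumes "i < k"
  shows "veblen i (veblen k x) = veblen k x"
  using assms
proof (induction k arbitrary: x)
  case (Suc k)
  then show ?case
    by (metis less_SucE veblen_Suc_fixpoint)
qed simp

text \<open>For positive \<open>k\<close> the value is a fixed point of \<open>omega_exp\<close>.
  This carries positivity and closure under addition from powers of omega to all Veblen
  values.\<close>

lemma veblen_eq_omega_exp: "\<exists>y. veblen k x = omega_exp y"
proof (cases k)
  case (Suc j)
  then have "veblen k x = omega_exp (veblen k x)"
    using veblen_fixpoint[of 0 k x] by simp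
  then show ?thesis ..
qed auto

lemma veblen_pos: "0 < veblen k x"
  using veblen_eq_omega_exp[of k x] omega_exp_pos by auto

lemma veblen_add_closed:
  "x < veblen k z \<Longrightarrow> y < veblen k z \<Longrightarrow> ord_add x y < veblen k z"
  using veblen_eq_omega_exp[of k z] omega_exp_add_closed by auto


section \<open>Denotation of constructive ordinals\<close>

lemma denote_add: "denote (o_add \<alpha> \<beta>) = ord_add (denote \<alpha>) (denote \<beta>)"
  by (induction \<beta>) (simp_all add: normal_fun_SUP[OF normal_ord_add])

lemma denote_mult:
  "0 < (denote \<alpha> :: 'a::infinite ordinal) \<Longrightarrow>
    denote (o_mult \<alpha> \<beta>) = (ord_mult (denote \<alpha>) (denote \<beta>) :: 'a ordinal)"
  by (induction \<beta>) (simp_all add: denote_add normal_fun_SUP[OF normal_ord_mult])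

lemma denote_o_nat: "denote (o_nat n) = ord_nat n"
  by (induction n) simp_all

lemma denote_omega: "denote o_omega = (ord_omega :: 'a::infinite ordinal)"
proof -
  have "denote o_omega = (SUP n. ord_nat (Suc n) :: 'a ordinal)"
    by (simp add: o_omega_def denote_o_nat)
  \<comment> \<open>The constructive omega starts at 1 instead of 0, which leaves the supremum
    unchanged.\<close>
  also have "\<dots> = (SUP n. ord_nat n)"
  proof (rule antisym)
    show "(SUP n. ord_nat (Suc n) :: 'a ordinal) \<le> (SUP n. ord_nat n)"
      by (rule cSUP_mono) (simp, simp, blast)
    have "(ord_nat n :: 'a ordinal) \<le> ord_nat (Suc n)" for n by (simp add: less_imp_le)
    then show "(SUP n. ord_nat n :: 'a ordinal) \<le> (SUP n. ord_nat (Suc n))"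
      by (intro cSUP_mono) (simp, simp, blast)
  qed
  finally show ?thesis by (simp add: ord_omega_SUP)
qed

lemma denote_exp: "denote (o_exp o_omega \<beta>) = omega_exp (denote \<beta>)"
  by (induction \<beta>)
    (simp_all add: denote_mult denote_omega omega_exp_pos omega_exp_succ
      normal_fun_SUP[OF normal_omega_exp])

text \<open>The outer induction is on the level, the inner one on the constructive argument. At zero
  and successors the limit of iterates denotes a least fixed point; at limits, continuity of level
  \<open>Suc k\<close> applies.\<close>

lemma denote_veblen:
  "denote (o_veblen k \<gamma>) = veblen k (denote \<gamma> :: 'a::infinite ordinal)"
proof (induction k arbitrary: \<gamma>)
  case 0
  then show ?case by (simp add: denote_exp)
next
  case (Suc k)
  have iter: "denote ((o_veblen k ^^ n) \<alpha>) = (veblen k ^^ n) (denote \<alpha> :: 'a ordinal)" for n \<alpha>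
    by (induction n) (simp_all add: Suc)
  have "denote (o_veblen_step (o_veblen k) \<gamma>) = veblen (Suc k) (denote \<gamma> :: 'a ordinal)"
  proof (induction \<gamma>)
    case OZero
    show ?case
      using normal_fun_least_fixpoint[OF normal_veblen, of k "0 :: 'a ordinal"]
      by (simp add: iter ord_rec_zero)
  next
    case (OSucc \<gamma>)
    have "denote (o_veblen_step (o_veblen k) (OSucc \<gamma>)) =
        (SUP n. (veblen k ^^ n) (ord_succ (veblen (Suc k) (denote \<gamma> :: 'a ordinal))))"
      using OSucc by (simp add: iter)
    also have "\<dots> = veblen (Suc k) (denote (OSucc \<gamma>))"
      \<comment> \<open>Lying strictly above the previous value means lying at or above its
        successor, where the iteration starts.\<close>
      unfolding normal_fun_least_fixpoint[OF normal_veblen, symmetric] ord_succ_le_iff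
        denote.simps veblen_Suc_succ ..
    finally show ?case .
  next
    case (OLim \<gamma>)
    then show ?case
      by (simp add: normal_fun_SUP[OF normal_veblen[of "Suc k"]] del: veblen.simps)
  qed
  then show ?case by simp
qed

section \<open>Ordinals denoted by closures\<close>

lemma denote_veblen_closure_less:
  assumes "\<alpha> \<in> veblen_closure k X"
    and "\<And>\<alpha>. \<alpha> \<in> X \<Longrightarrow> denote \<alpha> < veblen k x"
  shows "denote \<alpha> < veblen k x"
  using assms(1)
proof induction
  case (base \<alpha>)
  then show ?case by (rule assms(2))
next
  case (add \<alpha> \<beta>)
  then show ?case by (simp add: denote_add veblen_add_closed)
next
  case (veblen i \<alpha>)
  \<comment> \<open>The bound is itself a fixed point of \<open>veblen i\<close>, so strict
    monotonicity keeps the new value below it.\<close>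
  have "veblen i (denote \<alpha>) < veblen i (veblen k x)"
    using veblen by (simp add: normal_fun_less_iff[OF normal_veblen])
  then show ?case using veblen by (simp add: denote_veblen veblen_fixpoint)
qed

text \<open>Besides 0, \<open>X\<close> supplies the values of \<open>veblen k\<close> at arguments
  below \<open>x\<close>; every other ordinal below \<open>veblen k x\<close> arises from smaller
  ones by a sum or a lower Veblen function.\<close>

lemma denote_veblen_closure_ex:
  assumes zero: "OZero \<in> X"
    and vals: "\<And>b. b < x \<Longrightarrow> \<exists>\<alpha>\<in>X. denote \<alpha> = veblen k b"
    and "a < veblen k x"
  shows "\<exists>\<alpha>\<in>veblen_closure k X. denote \<alpha> = a"
  using assms(3)
proof (induction a rule: less_induct)
  case (less a)
  let ?D = "denote ` veblen_closure k X"
  have IH: "b \<in> ?D" if "b < a" for b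
    using less that by (force simp: image_iff)
  show ?case
  proof (cases "a = 0")
    case True
    then show ?thesis using zero veblen_closure.base by (intro bexI[of _ OZero]) auto
  next
    case False
    then have "0 < a" by (simp add: order_less_le)
    then have "a \<in> ?D"
    proof (cases rule: ordinal_omega_exp_or_sum)
      case (sum b c)
      then obtain \<beta> \<gamma> where "\<beta> \<in> veblen_closure k X" "\<gamma> \<in> veblen_closure k X"
        "denote \<beta> = b" "denote \<gamma> = c"
        using IH[of b] IH[of c] by blast
      then have "denote (o_add \<beta> \<gamma>) = a" "o_add \<beta> \<gamma> \<in> veblen_closure k X"
        using sum by (auto simp: denote_add intro: veblen_closure.add)
      then show ?thesis by blast
    next
      case (power y)
      \<comment> \<open>Climb through the levels, starting from a power of omega. If
        \<open>a = veblen i b\<close> with \<open>b\<close> different from \<open>a\<close>, then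
        \<open>b\<close> is smaller, hence denoted, and so is \<open>a\<close>; otherwise
        \<open>a\<close> is a fixed point and lies in the next range.\<close>
      have "a \<in> ?D \<or> a \<in> range (veblen i)" if "i \<le> k" for i
        using that
      proof (induction i)
        case 0
        then show ?case using power by simp
      next
        case (Suc i)
        show ?case
        proof (cases "a \<in> ?D")
          case False
          then obtain b where b: "a = veblen i b" using Suc by auto
          have "b \<noteq> a \<Longrightarrow> a \<in> ?D"
          proof -
            assume "b \<noteq> a"
            then have "b < a"
              using normal_fun_ge[OF normal_veblen, of b i] b by (simp add: order_less_le)
            then obtain \<beta> where "\<beta> \<in> veblen_closure k X" "denote \<beta> = b" using IH by blast
            then have "denote (o_veblen i \<beta>) = a" "o_veblen i \<beta> \<in> veblen_closure k X"
              using b Suc.prems by (auto simp: denote_veblen intro: veblen_closure.veblen)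
            then show ?thesis by blast
          qed
          then have "veblen i a = a" using False b by metis
          then show ?thesis using fixpoint_in_range_veblen_Suc by blast
        qed simp
      qed
      then consider "a \<in> ?D" | b where "a = veblen k b" by blast
      then show ?thesis
      proof cases
        case 2
        \<comment> \<open>The closure does not apply \<open>o_veblen k\<close>, but the bound on
          \<open>a\<close> forces \<open>b\<close> below \<open>x\<close>, where \<open>X\<close>
          provides a term for \<open>a\<close>.\<close>
        then have "b < x" using less.prems by (simp add: normal_fun_less_iff[OF normal_veblen])
        then obtain \<alpha> where "\<alpha> \<in> X" "denote \<alpha> = a" using vals 2 by blast
        then show ?thesis by (blast intro: veblen_closure.base)
      qed
    qed
    then show ?thesis by blast
  qed
qed

theorem theorem6p10:
  fixes k m :: nat
  assumes "m \<ge> 1"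
  shows "(\<forall>\<alpha> \<in> Phi_pow k m. denote \<alpha> < (veblen k ^^ m) (0 :: 'a::infinite ordinal)) \<and>
         (\<forall>a :: 'a ordinal. a < (veblen k ^^ m) 0 \<longrightarrow> (\<exists>\<alpha> \<in> Phi_pow k m. denote \<alpha> = a))"
  using assms
proof (induction m rule: dec_induct)
  case base
  have "denote \<alpha> < veblen k (0 :: 'a ordinal)" if "\<alpha> \<in> Phi k" for \<alpha>
    using that unfolding Phi_def by (rule denote_veblen_closure_less) (simp add: veblen_pos)
  \<comment> \<open>With \<open>x\<close> equal to 0, the requirement on values of
    \<open>veblen k\<close> is vacuous.\<close>
  moreover have "\<exists>\<alpha>\<in>Phi k. denote \<alpha> = a" if "a < veblen k 0" for a :: "'a ordinal"
    using that unfolding Phi_def by (intro denote_veblen_closure_ex) auto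
  ultimately show ?case by simp
next
  case (step m)
  obtain n where n: "m = Suc n" using step by (cases m) auto
  \<comment> \<open>By the induction hypothesis \<open>Phi_pow k m\<close> denotes exactly the
    ordinals below \<open>x\<close>, so \<open>?X\<close> denotes exactly 0 and the values of
    \<open>veblen k\<close> at arguments below \<open>x\<close>.\<close>
  define x where "x = (veblen k ^^ m) (0 :: 'a ordinal)"
  let ?X = "{OZero} \<union> {o_veblen k \<beta> | \<beta>. \<beta> \<in> Phi_pow k m}"
  have Phi: "Phi_pow k (Suc m) = veblen_closure k ?X" using n by simp
  have IH: "\<forall>\<alpha> \<in> Phi_pow k m. denote \<alpha> < x" "\<forall>a<x. \<exists>\<alpha> \<in> Phi_pow k m. denote \<alpha> = a"
    using step by (auto simp: x_def)
  have "denote \<alpha> < veblen k x" if "\<alpha> \<in> Phi_pow k (Suc m)" for \<alpha>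
    using that unfolding Phi
    by (rule denote_veblen_closure_less)
      (use IH in \<open>auto simp: veblen_pos denote_veblen normal_fun_less_iff[OF normal_veblen]\<close>)
  moreover have "\<exists>\<alpha>\<in>Phi_pow k (Suc m). denote \<alpha> = a" if "a < veblen k x" for a
    using that unfolding Phi
  proof (rule denote_veblen_closure_ex[rotated 2])
    show "\<exists>\<alpha>\<in>?X. denote \<alpha> = veblen k b" if "b < x" for b
    proof -
      obtain \<beta> where "\<beta> \<in> Phi_pow k m" "denote \<beta> = b" using IH(2) \<open>b < x\<close> by blast
      then have "o_veblen k \<beta> \<in> ?X" "denote (o_veblen k \<beta>) = veblen k b"
        by (auto simp: denote_veblen)
      then show ?thesis by blast
    qed
  qed simp
  ultimately show ?case by (simp add: x_def)
qed

end
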